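(* Let $v \in \mathcal{C}^1([0,1]\times X)$ satisfy $$l(x,u) + \frac{\partial v}{\partial t}(t,x) + \frac{\partial v}{\partial x}(t,x)\cdot f(x,u) \ge 0 \quad \text{for all } (x,u,t)\in X\times U\times[0,1],$$ $$l_T(x) - v(1,x) \ge 0 \quad \text{for all } x\in X_T.$$ Then $v(t_0,x_0)\le v^*(t_0,x_0)$ for every $x_0\in X$ and every $t_0\in[0,1]$.
   Context: For $A\subseteq\mathbb{R}^n$, $\mathcal{C}(A)$ is the space of continuous functions $A\to\mathbb{R}$ and $\mathcal{C}^1(A)$ the space of continuously differentiable functions $A\to\mathbb{R}$ (for a compact set $A$: functions admitting a $\mathcal{C}^1$ extension to an open neighbourhood of $A$, with partial derivatives on $A$ being those of a fixed such extension). The symbol $\cdot$ is the Euclidean dot product. Let $X\subseteq\mathbb{R}^{d_X}$ (state space) and $U\subseteq\mathbb{R}^{d_U}$ (control space) be compact, let $X_T\subseteq X$ be compact, let $f\in\mathcal{C}^1(X\times U)^{d_X}$ be the dynamics, let $l\in\mathcal{C}(X\times U)$ be the Lagrangian and $l_T\in\mathcal{C}(X_T)$ the terminal cost. The time interval is $[0,1]$, with terminal time $1$. Admissible trajectories: for $t_0\in[0,1]$ and $x_0\in X$, $\mathrm{traj}_{t_0,x_0}$ is the set of pairs $(x,u)$ of functions on $[t_0,1]$ such that $u:[t_0,1]\to U$ is measurable, $x(t)\in X$ for all $t\in[t_0,1]$, $x(t)=x_0+\int_{t_0}^t f(x(s),u(s))\,ds$ for all $t\in[t_0,1]$, and $x(1)\in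 X_T$. Value function: $v^*:[0,1]\times X\to\mathbb{R}\cup\{+\infty\}$, $$v^*(t_0,x_0)=\inf_{(x,u)\in\mathrm{traj}_{t_0,x_0}} \int_{t_0}^1 l(x(t),u(t))\,dt + l_T(x(1)),$$ with $v^*(t_0,x_0)=+\infty$ if $\mathrm{traj}_{t_0,x_0}=\emptyset$. *)

theory Defs
  imports "HOL-Analysis.Analysis"
begin

definition C1_open :: "'a::euclidean_space set \<Rightarrow> ('a \<Rightarrow> real) \<Rightarrow> bool" where
  "C1_open W g \<longleftrightarrow> open W \<and>
     (\<exists>g' :: 'a \<Rightarrow> 'a \<Rightarrow>\<^sub>L real.
        (\<forall>z\<in>W. (g has_derivative blinfun_apply (g' z)) (at z)) \<and> continuous_on W g')"

text \<open>On a compact set, being continuously differentiable means having a continuously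
  differentiable extension to an open neighbourhood. The extension is kept as an explicit
  argument because the partial derivatives on the set are, by convention, those of a fixed
  extension, and they may depend on its choice.\<close>

definition C1_extension :: "'a::euclidean_space set \<Rightarrow> ('a \<Rightarrow> real) \<Rightarrow> ('a \<Rightarrow> real) \<Rightarrow> bool" where
  "C1_extension A h g \<longleftrightarrow> (\<exists>W. A \<subseteq> W \<and> C1_open W g \<and> (\<forall>z\<in>A. g z = h z))"

definition C1_on :: "'a::euclidean_space set \<Rightarrow> ('a \<Rightarrow> real) \<Rightarrow> bool" where
  "C1_on A h \<longleftrightarrow> (\<exists>g. C1_extension A h g)"

definition partial_t :: "(real \<times> (real ^ 'n) \<Rightarrow> real) \<Rightarrow> real \<Rightarrow> real ^ 'n \<Rightarrow> real" where
  "partial_t w t x = deriv (\<lambda>s. w (s, x)) t"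

definition partial_x :: "(real \<times> (real ^ 'n) \<Rightarrow> real) \<Rightarrow> real \<Rightarrow> real ^ 'n \<Rightarrow> real ^ 'n" where
  "partial_x w t x = (\<chi> i. deriv (\<lambda>h. w (t, x + h *\<^sub>R axis i 1)) 0)"

text \<open>Trajectories and controls are total functions here, but only their values on
  \<open>{t0..1}\<close> matter. Since the Bochner integral of a non-integrable function is
  0 by convention, integrability of the velocity is stated explicitly.\<close>

definition traj ::
  "(real ^ 'n) set \<Rightarrow> (real ^ 'm) set \<Rightarrow> (real ^ 'n) set
   \<Rightarrow> ((real ^ 'n) \<times> (real ^ 'm) \<Rightarrow> real ^ 'n)
   \<Rightarrow> real \<Rightarrow> real ^ 'n \<Rightarrow> ((real \<Rightarrow> real ^ 'n) \<times> (real \<Rightarrow> real ^ 'm)) set" where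
  "traj X U XT f t0 x0 = {(x, u).
     u \<in> borel_measurable (lebesgue_on {t0..1}) \<and>
     (\<forall>t\<in>{t0..1}. u t \<in> U) \<and>
     (\<forall>t\<in>{t0..1}. x t \<in> X) \<and>
     set_integrable lebesgue {t0..1} (\<lambda>s. f (x s, u s)) \<and>
     (\<forall>t\<in>{t0..1}. x t = x0 + (LINT s:{t0..t}|lebesgue. f (x s, u s))) \<and>
     x 1 \<in> XT}"

text \<open>The infimum in \<open>ereal\<close> over the empty set is \<open>\<infinity>\<close>.\<close>

definition value_function ::
  "(real ^ 'n) set \<Rightarrow> (real ^ 'm) set \<Rightarrow> (real ^ 'n) set
   \<Rightarrow> ((real ^ 'n) \<times> (real ^ 'm) \<Rightarrow> real ^ 'n)
   \<Rightarrow> ((real ^ 'n) \<times> (real ^ 'm) \<Rightarrow> real) \<Rightarrow> (real ^ 'n \<Rightarrow> real)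
   \<Rightarrow> real \<Rightarrow> real ^ 'n \<Rightarrow> ereal" where
  "value_function X U XT f l lT t0 x0 =
     (INF (x, u) \<in> traj X U XT f t0 x0.
        ereal ((LINT t:{t0..1}|lebesgue. l (x t, u t)) + lT (x 1)))"

end

theory Submission
  imports Defs
begin

text \<open>Along an admissible trajectory, \<open>w (t, x t) + \<integral> l\<close> is nondecreasing because the hypothesis says
  that its derivative is nonnegative, and comparing its values at \<open>t0\<close> and \<open>1\<close> gives the bound.
  As the control is only measurable, the trajectory need not be differentiable at a given time, so
  the derivative of \<open>w\<close> is frozen at \<open>(t, x t)\<close> and integrated over a short interval around \<open>t\<close>;
  this bounds every increment from below by \<open>- \<epsilon>\<close> times the length of the interval, and a
  compactness argument over \<open>[t0, 1]\<close> makes the local bounds global.\<close>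

text \<open>Lower bounds of the form \<open>- \<epsilon> * (b - a)\<close> add up over adjacent
  intervals, so bisection carries them from short intervals to all of [c, d]; then \<epsilon> is
  arbitrary.\<close>

lemma increment_nonneg_of_local_bounds:
  fixes \<psi> :: "real \<Rightarrow> real"
  assumes "c \<le> d"
    and loc: "\<And>\<epsilon> t. 0 < \<epsilon> \<Longrightarrow> c \<le> t \<Longrightarrow> t \<le> d \<Longrightarrow>
      \<exists>\<delta>>0. \<forall>a b. c \<le> a \<and> a \<le> t \<and> t \<le> b \<and> b \<le> d \<and> b - a < \<delta> \<longrightarrow> - \<epsilon> * (b - a) \<le> \<psi> b - \<psi> a"
  shows "\<psi> c \<le> \<psi> d"
proof (rule field_le_epsilon)
  fix e :: real assume "0 < e"
  define \<epsilon> where "\<epsilon> = e / (d - c + 1)"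
  have "0 < \<epsilon>" using \<open>0 < e\<close> assms(1) by (simp add: \<epsilon>_def)
  \<comment> \<open>The vacuous premise is the range guard of \<open>P\<close> at (c, d).
    \<open>P\<close> needs the guard because the short intervals in the local case of
    \<open>Bolzano\<close> may stick out of [c, d].\<close>
  have "c \<le> c \<and> d \<le> d \<longrightarrow> - \<epsilon> * (d - c) \<le> \<psi> d - \<psi> c"
    using assms(1)
  proof (induction rule: Bolzano[where P = "\<lambda>a b. c \<le> a \<and> b \<le> d \<longrightarrow> - \<epsilon> * (b - a) \<le> \<psi> b - \<psi> a"])
    case (trans a b b')
    then show ?case by (auto simp: algebra_simps)
  next
    case (local t)
    with loc[OF \<open>0 < \<epsilon>\<close>, of t] show ?case by blast
  qed
  moreover have "\<epsilon> * (d - c) \<le> e"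
    using \<open>0 < e\<close> assms(1) by (simp add: \<epsilon>_def field_simps)
  ultimately show "\<psi> c \<le> \<psi> d + e" by simp
qed

text \<open>The bound on \<open>G\<close> makes \<open>p\<close> Lipschitz, so near t both the
  linearisation error of \<open>g\<close> and the variation of \<open>g'\<close> along
  \<open>p\<close> are controlled by the length of the interval. Time will enter as a coordinate of
  \<open>p\<close>.\<close>

lemma C1_increment_bound_along_curve:
  fixes p G :: "real \<Rightarrow> 'a::euclidean_space" and g :: "'a \<Rightarrow> real" and L :: "real \<Rightarrow> real"
  assumes "open W"
    and der: "\<And>z. z \<in> W \<Longrightarrow> (g has_derivative blinfun_apply (g' z)) (at z)"
    and cont: "continuous_on W g'"
    and "c \<le> d"
    and pW: "\<And>t. t \<in> {c..d} \<Longrightarrow> p t \<in> W"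
    and pG: "\<And>a b. c \<le> a \<Longrightarrow> a \<le> b \<Longrightarrow> b \<le> d \<Longrightarrow> (G has_integral (p b - p a)) {a..b}"
    and GM: "\<And>t. t \<in> {c..d} \<Longrightarrow> norm (G t) \<le> M"
    and L: "L integrable_on {c..d}"
    and nonneg: "\<And>t. t \<in> {c..d} \<Longrightarrow> 0 \<le> L t + blinfun_apply (g' (p t)) (G t)"
  shows "g (p c) \<le> g (p d) + integral {c..d} L"
proof -
  have M0: "0 \<le> M" using order_trans[OF norm_ge_zero GM[of c]] \<open>c \<le> d\<close> by simp
  have lip: "norm (p b - p a) \<le> M * (b - a)" if "c \<le> a" "a \<le> b" "b \<le> d" for a b
    using has_integral_bound_real[OF M0 finite.emptyI pG[OF that]] GM that by auto
  define \<psi> where "\<psi> t = g (p t) + integral {c..t} L" for t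
  have "\<psi> c \<le> \<psi> d"
  proof (rule increment_nonneg_of_local_bounds[OF \<open>c \<le> d\<close>])
    fix \<epsilon> t :: real assume "0 < \<epsilon>" and t: "c \<le> t" "t \<le> d"
    \<comment> \<open>Two errors of size \<open>\<eta> * M * (b - a)\<close> arise, from freezing
      \<open>g'\<close> and from linearising \<open>g\<close>; together they must stay below
      \<open>\<epsilon> * (b - a)\<close>. The \<open>+ 1\<close> covers M = 0.\<close>
    define \<eta> where "\<eta> = \<epsilon> / (2 * M + 1)"
    have \<eta>: "0 < \<eta>" using \<open>0 < \<epsilon>\<close> M0 by (simp add: \<eta>_def)
    have \<eta>M: "2 * M * \<eta> \<le> \<epsilon>" using \<open>0 < \<epsilon>\<close> M0 by (simp add: \<eta>_def field_simps)
    define D where "D = blinfun_apply (g' (p t))"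
    have ptW: "p t \<in> W" using pW t by simp
    interpret D: bounded_linear D unfolding D_def by (rule blinfun.bounded_linear_right)
    have Dlin: "bounded_linear D" by (rule D.bounded_linear_axioms)
    obtain \<delta>1 where \<delta>1: "0 < \<delta>1"
      and err: "\<And>q. norm (q - p t) < \<delta>1 \<Longrightarrow> norm (g q - g (p t) - D (q - p t)) \<le> \<eta> * norm (q - p t)"
      using der[OF ptW] \<eta> unfolding has_derivative_at_alt D_def by metis
    have "isCont g' (p t)" using cont \<open>open W\<close> ptW by (simp add: continuous_on_eq_continuous_at)
    then obtain \<delta>2 where \<delta>2: "0 < \<delta>2"
      and g'_close: "\<And>q. norm (q - p t) < \<delta>2 \<Longrightarrow> norm (g' q - g' (p t)) < \<eta>"
      using \<eta> unfolding continuous_at_eps_delta dist_norm by metis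
    define \<delta> where "\<delta> = min \<delta>1 \<delta>2 / (M + 1)"
    have \<delta>: "0 < \<delta>" using \<delta>1 \<delta>2 M0 by (simp add: \<delta>_def)
    have near: "norm (p r - p t) \<le> M * \<bar>r - t\<bar>" if "c \<le> r" "r \<le> d" for r
      using lip[of r t] lip[of t r] that t by (cases "r \<le> t") (auto simp: norm_minus_commute)
    have small: "norm (p r - p t) < min \<delta>1 \<delta>2" if "c \<le> r" "r \<le> d" "\<bar>r - t\<bar> < \<delta>" for r
    proof -
      have "norm (p r - p t) \<le> M * \<bar>r - t\<bar>" by (rule near[OF that(1,2)])
      also have "\<dots> \<le> M * \<delta>" using M0 that by (intro mult_left_mono) auto
      also have "\<dots> < (M + 1) * \<delta>" using \<delta> by (simp add: algebra_simps)
      also have "\<dots> = min \<delta>1 \<delta>2" using M0 by (simp add: \<delta>_def)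
      finally show ?thesis .
    qed
    have "- \<epsilon> * (b - a) \<le> \<psi> b - \<psi> a"
      if ab: "c \<le> a" "a \<le> t" "t \<le> b" "b \<le> d" "b - a < \<delta>" for a b
    proof -
      have Dint: "((\<lambda>r. D (G r)) has_integral D (p b - p a)) {a..b}"
        using has_integral_linear[OF pG Dlin, of a b] ab by (simp add: o_def)
      have Lab: "L integrable_on {a..b}" using integrable_subinterval_real[OF L] ab by auto
      have lower: "- L r - \<eta> * M \<le> D (G r)" if "r \<in> {a..b}" for r
      proof -
        have r: "r \<in> {c..d}" "\<bar>r - t\<bar> < \<delta>" using that ab by auto
        have "blinfun_apply (g' (p r)) (G r) - D (G r) = blinfun_apply (g' (p r) - g' (p t)) (G r)"
          by (simp add: D_def blinfun.diff_left)
        also have "\<dots> \<le> norm (g' (p r) - g' (p t)) * norm (G r)"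
          using norm_blinfun[of "g' (p r) - g' (p t)" "G r"] by simp
        also have "\<dots> \<le> \<eta> * M"
          using g'_close[of "p r"] small[of r] GM[of r] r \<eta> by (intro mult_mono) auto
        finally show ?thesis using nonneg[OF r(1)] by linarith
      qed
      have "((\<lambda>r. - L r - \<eta> * M) has_integral (- integral {a..b} L - \<eta> * M * (b - a))) {a..b}"
        using has_integral_diff[OF has_integral_neg[OF integrable_integral[OF Lab]]
            has_integral_const_real[of "\<eta> * M" a b]] ab by (simp add: mult.commute)
      from has_integral_le[OF this Dint] lower
      have D_ge: "- integral {a..b} L - \<eta> * M * (b - a) \<le> D (p b) - D (p a)" by (simp add: D.diff)
      \<comment> \<open>Linearising at t for both end points gives errors proportional to t - a and
        b - t, which add up to b - a because t lies between a and b.\<close>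
      have "\<bar>g (p r) - g (p t) - (D (p r) - D (p t))\<bar> \<le> \<eta> * (M * \<bar>r - t\<bar>)" if "r = a \<or> r = b" for r
      proof -
        have r: "c \<le> r" "r \<le> d" "\<bar>r - t\<bar> < \<delta>" using that ab by auto
        have "\<bar>g (p r) - g (p t) - (D (p r) - D (p t))\<bar> \<le> \<eta> * norm (p r - p t)"
          using err[of "p r"] small[OF r] by (simp add: D.diff)
        also have "\<dots> \<le> \<eta> * (M * \<bar>r - t\<bar>)"
          using near[OF r(1,2)] \<eta> by (intro mult_left_mono) auto
        finally show ?thesis .
      qed
      from this[of a] this[of b] ab
      have "D (p b) - D (p a) - \<eta> * M * (b - a) \<le> g (p b) - g (p a)"
        by (auto simp: algebra_simps)
      moreover have "integral {c..b} L = integral {c..a} L + integral {a..b} L"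
        using Henstock_Kurzweil_Integration.integral_combine[of c a b L]
          integrable_subinterval_real[OF L, of c b] ab by auto
      moreover have "2 * M * \<eta> * (b - a) \<le> \<epsilon> * (b - a)"
        using \<eta>M ab by (intro mult_right_mono) auto
      ultimately show ?thesis using D_ge by (simp add: \<psi>_def algebra_simps)
    qed
    then show "\<exists>\<delta>>0. \<forall>a b. c \<le> a \<and> a \<le> t \<and> t \<le> b \<and> b \<le> d \<and> b - a < \<delta>
        \<longrightarrow> - \<epsilon> * (b - a) \<le> \<psi> b - \<psi> a"
      using \<delta> by blast
  qed
  then show ?thesis by (simp add: \<psi>_def)
qed

text \<open>Links the total derivative used along curves to the coordinatewise \<open>deriv\<close>
  in the differential inequality: restricting to coordinate lines identifies \<open>D\<close> on a
  basis, and linearity does the rest.\<close>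

lemma has_derivative_eq_partials:
  fixes w :: "real \<times> (real ^ 'n) \<Rightarrow> real"
  assumes D: "(w has_derivative D) (at (t, x))"
  shows "D (s, y) = s * partial_t w t x + partial_x w t x \<bullet> y"
proof -
  interpret D: bounded_linear D by (rule has_derivative_bounded_linear[OF D])
  have "((\<lambda>s. w (s, x)) has_derivative (\<lambda>h. D (h, 0))) (at t)"
    by (rule has_derivative_compose[of "\<lambda>s. (s, x)" "\<lambda>h. (h, 0)" t UNIV w D])
      (auto intro!: derivative_eq_intros D)
  moreover have "(\<lambda>h. D (h, 0)) = (*) (D (1, 0))"
  proof
    show "D (h, 0) = D (1, 0) * h" for h
      using D.scaleR[of h "(1, 0)"] by simp
  qed
  ultimately have "partial_t w t x = D (1, 0)"
    unfolding partial_t_def by (intro DERIV_imp_deriv) (simp only: has_field_derivative_def)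
  then have Dt: "D (s, 0) = s * partial_t w t x"
    using D.scaleR[of s "(1, 0)"] by simp
  have px: "partial_x w t x $ i = D (0, axis i 1)" for i
  proof -
    have "((\<lambda>h. w (t, x + h *\<^sub>R axis i 1)) has_derivative (\<lambda>h. D (0, h *\<^sub>R axis i 1))) (at 0)"
      by (rule has_derivative_compose[of "\<lambda>h. (t, x + h *\<^sub>R axis i 1)"
            "\<lambda>h. (0, h *\<^sub>R axis i 1)" 0 UNIV w D])
        (use D in \<open>auto intro!: derivative_eq_intros\<close>)
    moreover have "(\<lambda>h. D (0, h *\<^sub>R axis i 1)) = (*) (D (0, axis i 1))"
    proof
      show "D (0, h *\<^sub>R axis i 1) = D (0, axis i 1) * h" for h
        using D.scaleR[of h "(0, axis i 1)"] by simp
    qed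
    ultimately have "deriv (\<lambda>h. w (t, x + h *\<^sub>R axis i 1)) 0 = D (0, axis i 1)"
      by (intro DERIV_imp_deriv) (simp only: has_field_derivative_def)
    then show ?thesis by (simp add: partial_x_def)
  qed
  have "(0, y) = (\<Sum>i\<in>UNIV. y $ i *\<^sub>R (0::real, axis i (1::real)))"
    by (simp add: sum_prod prod_eq_iff fst_sum snd_sum basis_expansion[of y]
        scalar_mult_eq_scaleR[symmetric])
  then have "D (0, y) = (\<Sum>i\<in>UNIV. y $ i * D (0, axis i 1))"
    by (simp add: D.sum D.scaleR del: scaleR_Pair)
  also have "\<dots> = partial_x w t x \<bullet> y"
    by (simp add: inner_vec_def px mult.commute)
  finally show ?thesis
    using D.add[of "(s, 0)" "(0, y)"] Dt by simp
qed

lemma C1_on_imp_continuous_on: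
  assumes "C1_on A h"
  shows "continuous_on A h"
proof -
  obtain g W where "A \<subseteq> W" "C1_open W g" "\<And>z. z \<in> A \<Longrightarrow> g z = h z"
    using assms unfolding C1_on_def C1_extension_def by blast
  then have "continuous_on A g"
    unfolding C1_open_def
    by (meson continuous_at_imp_continuous_on has_derivative_continuous subsetD)
  with \<open>\<And>z. z \<in> A \<Longrightarrow> g z = h z\<close> show ?thesis
    by (simp cong: continuous_on_cong)
qed

text \<open>Meant for the running cost, whose integrability is not part of \<open>traj\<close>: it
  is measurable, and bounded by compactness.\<close>

lemma absolutely_integrable_continuous_compose:
  fixes z :: "real \<Rightarrow> 'a::euclidean_space" and h :: "'a \<Rightarrow> real"
  assumes K: "compact K" and h: "continuous_on K h"
    and z: "z \<in> borel_measurable (lebesgue_on {a..b})" and zK: "\<And>t. t \<in> {a..b} \<Longrightarrow> z t \<in> K"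
  shows "(\<lambda>t. h (z t)) absolutely_integrable_on {a..b}"
proof -
  obtain B where B: "\<And>y. y \<in> K \<Longrightarrow> norm (h y) \<le> B"
    using compact_imp_bounded[OF compact_continuous_image[OF h K]] unfolding bounded_iff by blast
  \<comment> \<open>Nothing is known about \<open>h\<close> off \<open>K\<close>; cutting it off
    there gives a Borel function on the whole space, which can be composed with
    \<open>z\<close>.\<close>
  have "(\<lambda>y. indicator K y *\<^sub>R h y) \<in> borel_measurable borel"
    by (rule borel_measurable_continuous_on_indicator[OF borel_compact[OF K] h])
  from measurable_compose[OF z this]
  have "(\<lambda>t. indicator K (z t) *\<^sub>R h (z t)) \<in> borel_measurable (lebesgue_on {a..b})" .
  then have "(\<lambda>t. h (z t)) \<in> borel_measurable (lebesgue_on {a..b})"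
    by (rule measurable_cong[THEN iffD1, rotated]) (simp add: zK)
  then show ?thesis
    by (rule measurable_bounded_by_integrable_imp_absolutely_integrable[where g = "\<lambda>_. B"])
      (use B zK in auto)
qed

theorem proposition1:
  fixes X :: "(real ^ 'n) set" and U :: "(real ^ 'm) set" and XT :: "(real ^ 'n) set"
    and f :: "(real ^ 'n) \<times> (real ^ 'm) \<Rightarrow> real ^ 'n"
    and l :: "(real ^ 'n) \<times> (real ^ 'm) \<Rightarrow> real"
    and lT :: "real ^ 'n \<Rightarrow> real"
    and v w :: "real \<times> (real ^ 'n) \<Rightarrow> real"
    and t0 :: real and x0 :: "real ^ 'n"
  assumes "compact X" and "compact U" and "compact XT" and "XT \<subseteq> X"
    and "\<And>i. C1_on (X \<times> U) (\<lambda>z. f z $ i)"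
    and "continuous_on (X \<times> U) l"
    and "continuous_on XT lT"
    and "C1_extension ({0..1} \<times> X) v w"
    and "\<And>x u t. x \<in> X \<Longrightarrow> u \<in> U \<Longrightarrow> t \<in> {0..1} \<Longrightarrow>
           l (x, u) + partial_t w t x + partial_x w t x \<bullet> f (x, u) \<ge> 0"
    and "\<And>x. x \<in> XT \<Longrightarrow> lT x - v (1, x) \<ge> 0"
    and "x0 \<in> X" and "t0 \<in> {0..1}"
  shows "ereal (v (t0, x0)) \<le> value_function X U XT f l lT t0 x0"
proof -
  have K: "compact (X \<times> U)" using assms by (intro compact_Times)
  have "continuous_on (X \<times> U) f"
    using continuous_on_vec_lambda[of "X \<times> U" "\<lambda>i z. f z $ i"] C1_on_imp_continuous_on[OF assms(5)]
    by simp
  then obtain B where B: "\<And>z. z \<in> X \<times> U \<Longrightarrow> norm (f z) \<le> B"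
    using compact_imp_bounded[OF compact_continuous_image[OF _ K, of f]] unfolding bounded_iff by blast
  obtain W w' where W: "{0..1} \<times> X \<subseteq> W" "open W" "continuous_on W w'"
    and w': "\<And>z. z \<in> W \<Longrightarrow> (w has_derivative blinfun_apply (w' z)) (at z)"
    and wv: "\<And>z. z \<in> {0..1} \<times> X \<Longrightarrow> w z = v z"
    using assms(8) unfolding C1_extension_def C1_open_def by blast
  have t0: "0 \<le> t0" "t0 \<le> 1" using assms(12) by auto
  have "v (t0, x0) \<le> (LINT t:{t0..1}|lebesgue. l (x t, u t)) + lT (x 1)"
    if xu: "(x, u) \<in> traj X U XT f t0 x0" for x u
  proof -
    define F where "F = (\<lambda>s. f (x s, u s))"
    have um: "u \<in> borel_measurable (lebesgue_on {t0..1})"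
      and uU: "\<And>t. t \<in> {t0..1} \<Longrightarrow> u t \<in> U"
      and xX: "\<And>t. t \<in> {t0..1} \<Longrightarrow> x t \<in> X"
      and Fint: "F absolutely_integrable_on {t0..1}"
      and x_eq: "\<And>t. t \<in> {t0..1} \<Longrightarrow> x t = x0 + (LINT s:{t0..t}|lebesgue. F s)"
      and xT: "x 1 \<in> XT"
      using xu unfolding traj_def F_def by auto
    \<comment> \<open>From here on the Lebesgue integrals of \<open>traj\<close> are turned into
      gauge integrals, as the curve lemma requires.\<close>
    have Fi: "F integrable_on {a..b}" if "t0 \<le> a" "b \<le> 1" for a b
      using integrable_subinterval_real[OF set_lebesgue_integral_eq_integral(1)[OF Fint]] that
      by auto
    have x_int: "x t = x0 + integral {t0..t} F" if "t \<in> {t0..1}" for t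
      using x_eq[OF that] that
        set_lebesgue_integral_eq_integral(2)[OF absolutely_integrable_on_subinterval[OF Fint]]
      by auto
    have x_inc: "(F has_integral (x b - x a)) {a..b}" if "t0 \<le> a" "a \<le> b" "b \<le> 1" for a b
      using Henstock_Kurzweil_Integration.integral_combine[of t0 a b F] Fi[of t0 b] Fi[of a b]
        x_int[of a] x_int[of b] that
      by (auto simp: has_integral_iff algebra_simps)
    \<comment> \<open>Continuity of \<open>x\<close> as an indefinite integral supplies the
      measurability of the pair (x, u).\<close>
    have "continuous_on {t0..1} (\<lambda>t. x0 + integral {t0..t} F)"
      by (intro continuous_intros indefinite_integral_continuous_1 Fi) auto
    then have "continuous_on {t0..1} x"
      by (rule continuous_on_eq) (simp add: x_int)
    then have "x \<in> borel_measurable (lebesgue_on {t0..1})"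
      by (rule continuous_imp_measurable_on_sets_lebesgue) simp
    with um have "(\<lambda>t. (x t, u t)) \<in> borel_measurable (lebesgue_on {t0..1})"
      by (rule borel_measurable_Pair[rotated])
    from absolutely_integrable_continuous_compose[OF K assms(6) this]
    have L: "(\<lambda>t. l (x t, u t)) absolutely_integrable_on {t0..1}"
      using xX uU by auto
    \<comment> \<open>The space-time curve has velocity (1, F t), so the derivative of
      \<open>w\<close> along it plus \<open>l\<close> is the left side of the differential
      inequality.\<close>
    have "w (t0, x t0) \<le> w (1, x 1) + integral {t0..1} (\<lambda>t. l (x t, u t))"
    proof (rule C1_increment_bound_along_curve[where p = "\<lambda>t. (t, x t)" and G = "\<lambda>t. (1, F t)"
          and M = "1 + B", OF W(2) w' W(3) t0(2)])
      fix a b assume ab: "t0 \<le> a" "a \<le> b" "b \<le> (1::real)"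
      have "((\<lambda>t. (1::real, 0) + (0, F t)) has_integral
          ((b - a) *\<^sub>R (1, 0) + (0, x b - x a))) {a..b}"
        using has_integral_add[OF has_integral_const_real[of "(1::real, 0::real^'n)" a b]
            has_integral_linear[OF x_inc[OF ab] bounded_linear_Pair[OF bounded_linear_zero bounded_linear_ident]]]
          ab by (simp add: o_def)
      then show "((\<lambda>t. (1, F t)) has_integral (b, x b) - (a, x a)) {a..b}"
        by simp
    next
      fix t assume t: "t \<in> {t0..1}"
      then have tx: "(t, x t) \<in> {0..1} \<times> X" using t0 xX by auto
      then show "(t, x t) \<in> W" using W by blast
      show "norm (1::real, F t) \<le> 1 + B"
        using norm_Pair_le[of "1::real" "F t"] B[of "(x t, u t)"] xX[OF t] uU[OF t]
        by (auto simp: F_def)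
      show "0 \<le> l (x t, u t) + blinfun_apply (w' (t, x t)) (1, F t)"
        using has_derivative_eq_partials[OF w'[OF \<open>(t, x t) \<in> W\<close>], of 1 "F t"]
          assms(9)[OF xX[OF t] uU[OF t], of t] tx
        by (auto simp: F_def)
    qed (use L set_lebesgue_integral_eq_integral(1) in blast)+
    moreover have "x t0 = x0" using x_int[of t0] t0 by simp
    \<comment> \<open>Agreement of \<open>w\<close> with \<open>v\<close> is known on
      \<open>{0..1} \<times> X\<close>, and both end points lie there.\<close>
    moreover have "w (t0, x0) = v (t0, x0)" "w (1, x 1) = v (1, x 1)"
      using wv assms(4,11) xT t0 by auto
    ultimately show ?thesis
      using assms(10)[OF xT] set_lebesgue_integral_eq_integral(2)[OF L] by simp
  qed
  \<comment> \<open>This also covers an empty \<open>traj\<close>, where the infimum is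
    \<infinity>.\<close>
  then show ?thesis
    unfolding value_function_def by (auto intro!: INF_greatest)
qed

end
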